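(* For each even integer $n\geq 2$, there exists a bicriteria unconstrained skew-symmetric affine vector variational inequality $(\mathrm{P}_0)$ with $n$ variables (that is, there exist skew-symmetric matrices $M_1,M_2\in\mathbb{R}^{n\times n}$ and vectors $q_1,q_2\in\mathbb{R}^n$ defining the problem with $F_i(x)=M_ix+q_i$, $i=1,2$, and $K=\mathbb{R}^n$) such that $$\chi(\mathrm{Sol}(\mathrm{P}_0))=\chi(\mathrm{Sol}^w(\mathrm{P}_0))=\frac{n}{2}+1.$$
   Context: An affine vector variational inequality with $n$ variables and $m$ criteria is given by a nonempty polyhedral convex set $K\subset\mathbb{R}^n$ and affine operators $F_i(x)=M_ix+q_i$, $i=1,\dots,m$, with $M_i\in\mathbb{R}^{n\times n}$, $q_i\in\mathbb{R}^n$. For $x\in K$, $u\in\mathbb{R}^n$ put $F(x)(u)=(\langle F_1(x),u\rangle,\dots,\langle F_m(x),u\rangle)\in\mathbb{R}^m$, and let $C=\mathbb{R}^m_+$ be the nonnegative orthant. For such a problem $(\mathrm{P})$, the Pareto solution set $\mathrm{Sol}(\mathrm{P})$ is the set of $x\in K$ such that $F(x)(x-y)\notin C\setminus\{0\}$ for all $y\in K$. The weak Pareto solution set $\mathrm{Sol}^w(\mathrm{P})$ is the set of $x\in K$ such that $F(x)(x-y)\notin \mathrm{int}\,C$ for all $y\in K$. The problem is bicriteria if $m=2$, unconstrained if $K=\mathbb{R}^n$, and skew-symmetric if $M_i^T=-M_i$ for all $i$. For a topological space $S$ (here a subset of $\mathbb{R}^n$ with the induced topology), $\chi(S)$ denotes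 the number of connected components of $S$. *)

theory Defs
  imports "HOL-Analysis.Analysis"
begin

text \<open>An affine vector variational inequality in \<open>CARD('n)\<close> variables with \<open>CARD('m)\<close> criteria is
  given by a nonempty polyhedral convex set \<open>K\<close> and the affine operators
  \<open>x \<mapsto> M i *v x + q i\<close>, one for each criterion \<open>i\<close>.
  The conditions on \<open>K\<close> are not built into the definitions below; they hold trivially in the
  unconstrained case \<open>K = UNIV\<close>.\<close>

definition affine_op :: "('m \<Rightarrow> real^'n^'n) \<Rightarrow> ('m \<Rightarrow> real^'n) \<Rightarrow> 'm \<Rightarrow> real^'n \<Rightarrow> real^'n"
  where "affine_op M q i x = M i *v x + q i"

definition vvi_map ::
    "('m::finite \<Rightarrow> real^'n^'n) \<Rightarrow> ('m \<Rightarrow> real^'n) \<Rightarrow> real^'n \<Rightarrow> real^'n \<Rightarrow> real^'m"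
  where "vvi_map M q x u = (\<chi> i. affine_op M q i x \<bullet> u)"

definition nonneg_orthant :: "(real^'m) set"
  where "nonneg_orthant = {v. \<forall>i. 0 \<le> v $ i}"

definition pareto_sol ::
    "(real^'n) set \<Rightarrow> ('m::finite \<Rightarrow> real^'n^'n) \<Rightarrow> ('m \<Rightarrow> real^'n) \<Rightarrow> (real^'n) set"
  where "pareto_sol K M q =
    {x \<in> K. \<forall>y\<in>K. vvi_map M q x (x - y) \<notin> nonneg_orthant - {0}}"

definition weak_pareto_sol ::
    "(real^'n) set \<Rightarrow> ('m::finite \<Rightarrow> real^'n^'n) \<Rightarrow> ('m \<Rightarrow> real^'n) \<Rightarrow> (real^'n) set"
  where "weak_pareto_sol K M q =
    {x \<in> K. \<forall>y\<in>K. vvi_map M q x (x - y) \<notin> interior nonneg_orthant}"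

definition skew_symmetric :: "real^'n^'n \<Rightarrow> bool"
  where "skew_symmetric A \<longleftrightarrow> transpose A = - A"

end

theory Submission
  imports Defs
begin

text \<open>By Gordan's theorem of the alternative, \<open>x\<close> is a weak Pareto solution iff some convex
  combination of \<open>F\<^sub>1 x\<close> and \<open>F\<^sub>2 x\<close> vanishes, and a Pareto solution iff this happens with both
  weights positive. Pair up the \<open>n = 2k\<close> coordinates and let \<open>M\<^sub>1\<close>, \<open>M\<^sub>2\<close> be block diagonal with
  blocks that are multiples of the rotation by a right angle, chosen so that the combinations of
  \<open>M\<^sub>1\<close> and \<open>M\<^sub>2\<close> have the factors \<open>\<mu> - 1, \<dots>, \<mu> - k\<close>, where \<open>\<mu>\<close> runs from \<open>1/4\<close> to \<open>k + 3/4\<close>.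
  With a suitable constant \<open>q\<^sub>1 = q\<^sub>2\<close> the scalarised system has no solution for
  \<open>\<mu> \<in> {1, \<dots>, k}\<close>, and otherwise exactly one, whose coordinates are the numbers \<open>1 / (\<mu> - j)\<close>.
  As \<open>\<mu>\<close> depends continuously on the solution, the solution set has one component for each of
  the \<open>k + 1\<close> intervals that remain after deleting \<open>1, \<dots>, k\<close>.\<close>

section \<open>Topology: reading off components from a partition into open connected pieces\<close>

lemma components_eq_disjoint_openin:
  assumes disj: "pairwise disjnt A" and un: "\<Union>A = S"
    and A: "\<And>X. X \<in> A \<Longrightarrow> openin (top_of_set S) X \<and> connected X \<and> X \<noteq> {}"
  shows "components S = A"
proof -
  have comp: "X \<in> components S" if X: "X \<in> A" for X
  proof -
    \<comment> \<open>The complement of a piece is the union of the other pieces, hence open, so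
      each piece is clopen in \<open>S\<close>. A connected \<open>Y\<close> containing it cannot be
      larger, and this is maximality.\<close>
    have "S - X = \<Union>(A - {X})"
      using disj un X by (auto simp: pairwise_def disjnt_def)
    moreover have "openin (top_of_set S) (\<Union>(A - {X}))"
      using A by (intro openin_Union) auto
    ultimately have cl: "closedin (top_of_set S) X"
      using un X by (auto simp: closedin_def)
    have "Y = X" if Y: "Y \<noteq> {}" "X \<subseteq> Y" "Y \<subseteq> S" "connected Y" for Y
    proof -
      have "openin (top_of_set Y) X" "closedin (top_of_set Y) X"
        using A[OF X] cl Y by (auto intro: openin_subset_trans closedin_subset_trans)
      then show ?thesis
        using Y A[OF X] by (auto simp: connected_clopen)
    qed
    then show ?thesis
      using A[OF X] X un by (auto simp: in_components_maximal)
  qed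
  moreover have "C \<in> A" if C: "C \<in> components S" for C
  proof -
    obtain x where x: "x \<in> C"
      using in_components_nonempty[OF C] by auto
    then obtain X where X: "X \<in> A" "x \<in> X"
      using un in_components_subset[OF C] by auto
    then show ?thesis
      using components_eq[OF C comp[OF X(1)]] x by auto
  qed
  ultimately show ?thesis by auto
qed

section \<open>Scalarisation of bicriteria problems by theorems of the alternative\<close>

lemma interior_nonneg_orthant:
  "interior (nonneg_orthant :: (real^'m::finite) set) = {v. \<forall>i. 0 < v $ i}"
proof (intro equalityI)
  show "{v. \<forall>i. 0 < v $ i} \<subseteq> interior (nonneg_orthant :: (real^'m) set)"
  proof (rule interior_maximal)
    have "open (\<Inter>i\<in>UNIV. {v::real^'m. v $ i > 0})"
      by (intro open_INT ballI open_halfspace_component_gt_cart) simp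
    then show "open {v::real^'m. \<forall>i. 0 < v $ i}"
      by (simp add: INTER_eq)
  qed (auto simp: nonneg_orthant_def less_imp_le)
  have "interior nonneg_orthant \<subseteq> {v::real^'m. v $ i > 0}" for i
    using interior_mono[of nonneg_orthant "{v::real^'m. v $ i \<ge> 0}"]
    by (auto simp: nonneg_orthant_def interior_halfspace_component_ge)
  then show "interior nonneg_orthant \<subseteq> {v::real^'m. \<forall>i. 0 < v $ i}" by blast
qed

text \<open>A suitable \<open>u\<close> is the normal of a hyperplane strictly separating 0 from the
  compact segment between \<open>a\<close> and \<open>b\<close>; conversely, such a \<open>u\<close>
  has positive inner product with every point of that segment.\<close>

lemma gordan_two:
  fixes a b :: "'a::euclidean_space"
  shows "(\<exists>u. a \<bullet> u > 0 \<and> b \<bullet> u > 0) \<longleftrightarrow> (\<forall>l\<in>{0..1}. (1 - l) *\<^sub>R a + l *\<^sub>R b \<noteq> 0)"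
proof
  assume "\<exists>u. a \<bullet> u > 0 \<and> b \<bullet> u > 0"
  then obtain u where u: "a \<bullet> u > 0" "b \<bullet> u > 0" by auto
  have "((1 - l) *\<^sub>R a + l *\<^sub>R b) \<bullet> u > 0" if l: "l \<in> {0..1}" for l
  proof (cases "l = 0")
    case False
    with l u have "(1 - l) * (a \<bullet> u) \<ge> 0" "l * (b \<bullet> u) > 0" by auto
    then show ?thesis by (simp add: inner_add_left)
  qed (use u in auto)
  then show "\<forall>l\<in>{0..1}. (1 - l) *\<^sub>R a + l *\<^sub>R b \<noteq> 0" by force
next
  assume "\<forall>l\<in>{0..1}. (1 - l) *\<^sub>R a + l *\<^sub>R b \<noteq> 0"
  then have "0 \<notin> closed_segment a b"
    by (force simp: closed_segment_def)
  then obtain u c where "c > 0" "\<forall>x\<in>closed_segment a b. u \<bullet> x > c"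
    using separating_hyperplane_closed_0[of "closed_segment a b"]
    by (auto simp: closed_segment)
  then have "a \<bullet> u > 0" "b \<bullet> u > 0"
    by (force simp: inner_commute)+
  then show "\<exists>u. a \<bullet> u > 0 \<and> b \<bullet> u > 0" by auto
qed

text \<open>If neither vector is 0, the weights 0 and 1 give nonzero combinations as well, and
  \<open>gordan_two\<close> applies. The case of a zero vector is treated directly.\<close>

lemma gordan_two_strict:
  fixes a b :: "'a::euclidean_space"
  shows "(\<exists>u. a \<bullet> u \<ge> 0 \<and> b \<bullet> u \<ge> 0 \<and> (a \<bullet> u \<noteq> 0 \<or> b \<bullet> u \<noteq> 0)) \<longleftrightarrow>
    (\<forall>l\<in>{0<..<1}. (1 - l) *\<^sub>R a + l *\<^sub>R b \<noteq> 0)"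
proof
  assume "\<exists>u. a \<bullet> u \<ge> 0 \<and> b \<bullet> u \<ge> 0 \<and> (a \<bullet> u \<noteq> 0 \<or> b \<bullet> u \<noteq> 0)"
  then obtain u where u: "a \<bullet> u \<ge> 0" "b \<bullet> u \<ge> 0" "a \<bullet> u \<noteq> 0 \<or> b \<bullet> u \<noteq> 0" by auto
  have "((1 - l) *\<^sub>R a + l *\<^sub>R b) \<bullet> u \<noteq> 0" if l: "l \<in> {0<..<1}" for l
  proof -
    have "(1 - l) * (a \<bullet> u) \<ge> 0" "l * (b \<bullet> u) \<ge> 0" using l u by auto
    then show ?thesis
      using l u(3) by (auto simp: inner_add_left add_nonneg_eq_0_iff)
  qed
  then show "\<forall>l\<in>{0<..<1}. (1 - l) *\<^sub>R a + l *\<^sub>R b \<noteq> 0" by force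
next
  assume *: "\<forall>l\<in>{0<..<1}. (1 - l) *\<^sub>R a + l *\<^sub>R b \<noteq> 0"
  show "\<exists>u. a \<bullet> u \<ge> 0 \<and> b \<bullet> u \<ge> 0 \<and> (a \<bullet> u \<noteq> 0 \<or> b \<bullet> u \<noteq> 0)"
  proof (cases "a = 0 \<or> b = 0")
    case True
    moreover have "a \<noteq> 0 \<or> b \<noteq> 0"
      using *[rule_format, of "1/2"] by auto
    ultimately show ?thesis
      \<comment> \<open>Exactly one of the vectors is 0, so \<open>a + b\<close> is the other one
        and has positive inner product with itself.\<close>
      by (intro exI[of _ "a + b"]) auto
  next
    case False
    have "(1 - l) *\<^sub>R a + l *\<^sub>R b \<noteq> 0" if "l \<in> {0..1}" for l
      using * False that by (cases "l = 0 \<or> l = 1") auto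
    then show ?thesis
      using gordan_two[of a b] by (metis less_imp_le less_irrefl)
  qed
qed

text \<open>In the unconstrained problem the directions \<open>x - y\<close> exhaust the whole
  space, so the point \<open>y\<close> can be replaced by a free direction \<open>u\<close>.\<close>

lemma all_diff_eq_all: "(\<forall>y. P (x - y)) \<longleftrightarrow> (\<forall>u. P u)" for x :: "'a::ab_group_add"
proof -
  have "surj (\<lambda>y. x - y)"
    by (rule surjI[where f = "\<lambda>u. x - u"]) simp
  then show ?thesis by (metis surjD)
qed

lemma weak_pareto_sol_bicriteria:
  fixes M :: "2 \<Rightarrow> real^'n^'n"
  shows "weak_pareto_sol UNIV M q =
    {x. \<exists>l\<in>{0..1}. (1 - l) *\<^sub>R affine_op M q 1 x + l *\<^sub>R affine_op M q 2 x = 0}"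
proof -
  have "(\<forall>y. vvi_map M q x (x - y) \<notin> interior nonneg_orthant) \<longleftrightarrow>
      \<not> (\<exists>u. affine_op M q 1 x \<bullet> u > 0 \<and> affine_op M q 2 x \<bullet> u > 0)" for x
    unfolding interior_nonneg_orthant vvi_map_def
      all_diff_eq_all[where P = "\<lambda>u. (\<chi> i. affine_op M q i x \<bullet> u) \<notin> _"]
    by (simp add: forall_2)
  then show ?thesis
    unfolding weak_pareto_sol_def gordan_two by auto
qed

lemma pareto_sol_bicriteria:
  fixes M :: "2 \<Rightarrow> real^'n^'n"
  shows "pareto_sol UNIV M q =
    {x. \<exists>l\<in>{0<..<1}. (1 - l) *\<^sub>R affine_op M q 1 x + l *\<^sub>R affine_op M q 2 x = 0}"
proof -
  have "(\<forall>y. vvi_map M q x (x - y) \<notin> nonneg_orthant - {0}) \<longleftrightarrow>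
      \<not> (\<exists>u. affine_op M q 1 x \<bullet> u \<ge> 0 \<and> affine_op M q 2 x \<bullet> u \<ge> 0 \<and>
        (affine_op M q 1 x \<bullet> u \<noteq> 0 \<or> affine_op M q 2 x \<bullet> u \<noteq> 0))" for x
    unfolding nonneg_orthant_def vvi_map_def
      all_diff_eq_all[where P = "\<lambda>u. (\<chi> i. affine_op M q i x \<bullet> u) \<notin> _"]
    by (auto simp: forall_2 vec_eq_iff)
  then show ?thesis
    unfolding pareto_sol_def gordan_two_strict by auto
qed

section \<open>Blocks of size two on an abstract index type: partner \<open>p\<close>, sign
  \<open>s\<close>, block number \<open>T\<close>\<close>

lemma even_card_pairing:
  assumes "even CARD('n::finite)"
  obtains p :: "'n::finite \<Rightarrow> 'n" and s :: "'n \<Rightarrow> real" and T :: "'n \<Rightarrow> nat"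
  where "\<And>a. p (p a) = a" "\<And>a. s (p a) = - s a" "\<And>a. s a \<noteq> 0"
    "\<And>a. T (p a) = T a" "range T = {1..CARD('n) div 2}"
proof -
  define n where "n = CARD('n)"
  have n: "even n" using assms by (simp add: n_def)
  obtain e :: "'n \<Rightarrow> nat" where e: "bij_betw e UNIV {0..<n}"
    using ex_bij_betw_finite_nat[of "UNIV :: 'n set"] by (auto simp: n_def)
  define f where "f = inv_into UNIV e"
  have ef: "e (f m) = m" if "m < n" for m
    using bij_betw_inv_into_right[OF e, of m] that by (simp add: f_def)
  have fe: "f (e a) = a" for a
    using bij_betw_inv_into_left[OF e, of a] by (simp add: f_def)
  have en: "e a < n" for a
    using bij_betwE[OF e] by auto
  \<comment> \<open>\<open>r\<close> swaps 2i and 2i + 1. It stays below \<open>n\<close> because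
    \<open>n\<close> is even; the partner map is \<open>r\<close> transported along the enumeration
    \<open>e\<close>.\<close>
  define r :: "nat \<Rightarrow> nat" where "r m = (if even m then m + 1 else m - 1)" for m
  have r: "r m < n" if "m < n" for m
    using that n by (auto simp: r_def elim!: evenE)
  have ep: "e (f (r (e a))) = r (e a)" for a
    by (intro ef r en)
  have rr: "r (r m) = m" "even (r m) = odd m" "r m div 2 = m div 2" for m
    by (auto simp: r_def elim!: oddE)
  show thesis
  proof
    show "f (r (e (f (r (e a))))) = a" for a
      by (simp add: ep rr fe)
    show "(if even (e (f (r (e a)))) then 1 else -1) = - (if even (e a) then 1 else -1 :: real)" for a
      by (simp add: ep rr)
    show "(if even (e a) then 1 else -1 :: real) \<noteq> 0" for a
      by simp
    show "e (f (r (e a))) div 2 + 1 = e a div 2 + 1" for a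
      by (simp add: ep rr)
    show "range (\<lambda>a. e a div 2 + 1) = {1..CARD('n) div 2}"
    proof (intro equalityI subsetI)
      fix j assume "j \<in> range (\<lambda>a. e a div 2 + 1)"
      then obtain a where "j = e a div 2 + 1" by auto
      then show "j \<in> {1..CARD('n) div 2}"
        using en[of a] n unfolding n_def[symmetric] by (auto elim!: evenE)
    next
      fix j assume "j \<in> {1..CARD('n) div 2}"
      then have j: "1 \<le> j" "2 * (j - 1) < n"
        by (auto simp: n_def)
      then have "j = e (f (2 * (j - 1))) div 2 + 1"
        by (simp add: ef)
      then show "j \<in> range (\<lambda>a. e a div 2 + 1)" by blast
    qed
  qed
qed

section \<open>Components of the curve of reciprocals\<close>

lemma components_reciprocal_curve:
  fixes T :: "'n::finite \<Rightarrow> nat" and I :: "real set"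
  assumes T: "range T = {1..k}"
    and I: "convex I" "I \<subseteq> {0<..<real k + 1}" "\<And>j. j \<le> k \<Longrightarrow> real j + 1/2 \<in> I"
  defines "S \<equiv> {x :: real^'n. \<exists>\<mu>\<in>I. \<forall>a. (\<mu> - real (T a)) * x $ a = 1}"
  shows "finite (components S) \<and> card (components S) = k + 1"
proof -
  define g :: "real \<Rightarrow> real^'n" where "g \<mu> = (\<chi> a. 1 / (\<mu> - real (T a)))" for \<mu>
  define J where "J j = I \<inter> {real j<..<real j + 1}" for j
  define A where "A = (\<lambda>j. g ` J j) ` {..k}"
  \<comment> \<open>A single coordinate recovers the parameter; \<open>undefined\<close> serves as
    an arbitrary index.\<close>
  define h :: "real^'n \<Rightarrow> real" where "h x = real (T undefined) + 1 / x $ undefined" for x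
  have ne: "\<mu> \<noteq> real (T a)" if "\<mu> \<in> J j" for \<mu> j a
    using that by (auto simp: J_def)
  \<comment> \<open>This holds even at \<open>\<mu> = T undefined\<close>, since 1/0 = 0; hence
    \<open>g\<close> is injective on all reals.\<close>
  have hg: "h (g \<mu>) = \<mu>" for \<mu>
    by (simp add: h_def g_def)
  have gS: "g \<mu> \<in> S" if "\<mu> \<in> J j" for \<mu> j
    using that ne[OF that] by (auto simp: S_def g_def J_def)
  have SJ: "\<exists>j\<le>k. \<exists>\<mu>\<in>J j. x = g \<mu>" if x: "x \<in> S" for x
  proof -
    obtain \<mu> where \<mu>: "\<mu> \<in> I" "\<And>a. (\<mu> - real (T a)) * x $ a = 1"
      using x by (auto simp: S_def)
    have neq: "\<mu> \<noteq> real (T a)" for a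
      using \<mu>(2)[of a] by auto
    define j where "j = nat \<lfloor>\<mu>\<rfloor>"
    have pos: "0 < \<mu>" "\<mu> < real k + 1" using \<mu>(1) I(2) by auto
    then have j: "real j \<le> \<mu>" "\<mu> < real j + 1"
      by (auto simp: j_def)
    then have jk: "j \<le> k" using pos by linarith
    \<comment> \<open>An integer parameter in (0, k + 1) is some \<open>T a\<close>, and the
      equation for that \<open>a\<close> would read 0 = 1.\<close>
    have "\<mu> \<noteq> real j"
    proof
      assume eq: "\<mu> = real j"
      then have "j \<in> range T" using T jk pos by auto
      then show False using neq eq by auto
    qed
    then have "\<mu> \<in> J j" using j \<mu>(1) by (auto simp: J_def)
    moreover have "x = g \<mu>"
      using \<mu>(2) neq by (auto simp: g_def vec_eq_iff field_simps)
    ultimately show ?thesis using jk by auto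
  qed
  have Jdisj: "J i \<inter> J j = {}" if "i \<noteq> j" for i j
    using that by (auto simp: J_def)
  have Jne: "real j + 1/2 \<in> J j" if "j \<le> k" for j
    using I(3)[OF that] by (auto simp: J_def)
  have conth: "continuous_on S h"
  proof -
    have "x $ undefined \<noteq> 0" if x: "x \<in> S" for x
    proof -
      obtain \<mu> where "\<And>a. (\<mu> - real (T a)) * x $ a = 1"
        using x by (auto simp: S_def)
      from this[of undefined] show ?thesis by auto
    qed
    then show ?thesis
      unfolding h_def by (intro continuous_intros) auto
  qed
  have open': "openin (top_of_set S) (g ` J j)" if "j \<le> k" for j
  proof -
    \<comment> \<open>Openness of a piece comes from the continuity of the inverse
      \<open>h\<close>.\<close>
    have "g ` J j = S \<inter> h -` {real j<..<real j + 1}"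
    proof (intro equalityI subsetI)
      fix x assume "x \<in> g ` J j"
      then show "x \<in> S \<inter> h -` {real j<..<real j + 1}"
        using gS hg by (auto simp: J_def)
    next
      fix x assume x: "x \<in> S \<inter> h -` {real j<..<real j + 1}"
      then obtain i \<mu> where "\<mu> \<in> J i" "x = g \<mu>" using SJ by blast
      then show "x \<in> g ` J j"
        using x hg by (auto simp: J_def)
    qed
    then show ?thesis
      using continuous_openin_preimage_gen[OF conth, of "{real j<..<real j + 1}"] by simp
  qed
  have conn: "connected (g ` J j)" for j
  proof (rule connected_continuous_image)
    show "continuous_on (J j) g"
      unfolding g_def using ne by (intro continuous_intros) auto
    show "connected (J j)"
      unfolding J_def using I(1) by (intro convex_connected convex_Int) auto
  qed
  have disj: "g ` J i \<inter> g ` J j = {}" if "i \<noteq> j" for i j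
  proof -
    have "inj g"
      by (rule inj_on_inverseI[of _ h]) (rule hg)
    then show ?thesis
      using Jdisj[OF that] by (simp flip: image_Int)
  qed
  have "components S = A"
  proof (rule components_eq_disjoint_openin)
    show "pairwise disjnt A"
      unfolding A_def by (auto simp: pairwise_image pairwise_def disjnt_def intro!: disj)
    show "\<Union>A = S"
      using SJ gS unfolding A_def by fast
    fix X assume "X \<in> A"
    then obtain j where "j \<le> k" "X = g ` J j"
      by (auto simp: A_def)
    then show "openin (top_of_set S) X \<and> connected X \<and> X \<noteq> {}"
      using open' conn Jne by auto
  qed
  \<comment> \<open>Disjoint pieces could coincide only if empty, which the midpoints j + 1/2
    exclude; so there really are k + 1 of them.\<close>
  moreover have "inj_on (\<lambda>j. g ` J j) {..k}"
  proof (rule inj_onI, rule ccontr)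
    fix i j assume "i \<in> {..k}" "g ` J i = g ` J j" "i \<noteq> j"
    then have "g ` J i = {}"
      using disj[of i j] by simp
    then show False
      using Jne[of i] \<open>i \<in> {..k}\<close> by auto
  qed
  ultimately show ?thesis
    by (simp add: A_def card_image)
qed

section \<open>The skew-symmetric problem and its two solution sets\<close>

theorem theorem3p2:
  assumes "CARD('n::finite) \<ge> 2" and "even CARD('n)"
  shows "\<exists>(M :: 2 \<Rightarrow> real^'n^'n) (q :: 2 \<Rightarrow> real^'n).
    (\<forall>i. skew_symmetric (M i)) \<and>
    finite (components (pareto_sol UNIV M q)) \<and>
    card (components (pareto_sol UNIV M q)) = CARD('n) div 2 + 1 \<and>
    finite (components (weak_pareto_sol UNIV M q)) \<and>
    card (components (weak_pareto_sol UNIV M q)) = CARD('n) div 2 + 1"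
proof -
  obtain p :: "'n \<Rightarrow> 'n" and s :: "'n \<Rightarrow> real" and T :: "'n \<Rightarrow> nat"
    where pp: "\<And>a. p (p a) = a" and sp: "\<And>a. s (p a) = - s a" and s0: "\<And>a. s a \<noteq> 0"
      and Tp: "\<And>a. T (p a) = T a" and T: "range T = {1..CARD('n) div 2}"
    using even_card_pairing[OF assms(2)] by blast
  define k where "k = CARD('n) div 2"
  \<comment> \<open>The weight \<open>l\<close> is rescaled to \<mu>. The end points lie in (0, 1/2)
    and (k + 1/2, k + 1), so the open and the closed interval both contain every midpoint and meet
    the same integers.\<close>
  define m where "m l = (1 - l) * (1/4) + l * (real k + 3/4)" for l
  \<comment> \<open>The criteria take the end values \<open>m 0\<close> and \<open>m 1\<close>.
    Passing from \<open>a\<close> to \<open>p a\<close> flips \<open>s\<close> and keeps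
    \<open>T\<close>, whence skew-symmetry.\<close>
  define M :: "2 \<Rightarrow> real^'n^'n" where
    "M i = (\<chi> a b. if b = p a then s a * (m (if i = 1 then 0 else 1) - real (T a)) else 0)" for i
  define q :: "2 \<Rightarrow> real^'n" where "q i = (\<chi> a. - s a)" for i
  define S where "S I = {x :: real^'n. \<exists>\<mu>\<in>I. \<forall>a. (\<mu> - real (T a)) * x $ a = 1}" for I
  have skew: "skew_symmetric (M i)" for i
  proof -
    have "M i $ b $ a = - M i $ a $ b" for a b
      using pp sp Tp by (auto simp: M_def)
    moreover have "skew_symmetric (M i) \<longleftrightarrow> (\<forall>a b. M i $ b $ a = - M i $ a $ b)"
      by (simp add: skew_symmetric_def transpose_def vec_eq_iff)
    ultimately show ?thesis by blast
  qed
  have op: "affine_op M q i x $ a =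
      s a * ((m (if i = 1 then 0 else 1) - real (T a)) * x $ p a - 1)" for i x a
  proof -
    have "(M i *v x) $ a = s a * (m (if i = 1 then 0 else 1) - real (T a)) * x $ p a"
      unfolding M_def matrix_vector_mult_def
      by (simp add: if_distrib[where f = "\<lambda>z. z * _"] cong: if_cong)
    then show ?thesis
      by (simp add: affine_op_def q_def right_diff_distrib)
  qed
  \<comment> \<open>The weights sum to 1 and \<open>m\<close> is affine, so the combination has the
    form of a single criterion with value \<open>m l\<close>; the factor \<open>s a\<close> cancels
    afterwards.\<close>
  have "((1 - l) *\<^sub>R affine_op M q 1 x + l *\<^sub>R affine_op M q 2 x) $ a =
      s a * ((m l - real (T a)) * x $ p a - 1)" for l x a
    by (simp add: op) (simp add: m_def algebra_simps)
  then have "(1 - l) *\<^sub>R affine_op M q 1 x + l *\<^sub>R affine_op M q 2 x = 0 \<longleftrightarrow>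
      (\<forall>a. (m l - real (T a)) * x $ p a = 1)" for l x
    unfolding vec_eq_iff using s0 by simp
  \<comment> \<open>Reindexing along the involution \<open>p\<close>, which preserves
    \<open>T\<close>.\<close>
  also have "(\<forall>a. (m l - real (T a)) * x $ p a = 1) \<longleftrightarrow>
      (\<forall>a. (m l - real (T a)) * x $ a = 1)" for l and x :: "real^'n"
    by (metis pp Tp)
  finally have zero: "(1 - l) *\<^sub>R affine_op M q 1 x + l *\<^sub>R affine_op M q 2 x = 0 \<longleftrightarrow>
      (\<forall>a. (m l - real (T a)) * x $ a = 1)" for l x .
  have lt: "1/4 < real k + 3/4" by simp
  have mo: "m ` {0<..<1} = {1/4<..<real k + 3/4}"
    using open_segment_image_interval[of "1/4" "real k + 3/4"] lt
    by (simp add: m_def open_segment_eq_real_ivl)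
  have mc: "m ` {0..1} = {1/4..real k + 3/4}"
    using closed_segment_image_interval[of "1/4" "real k + 3/4"] lt
    by (simp add: m_def closed_segment_eq_real_ivl)
  have P: "pareto_sol UNIV M q = S {1/4<..<real k + 3/4}"
    unfolding pareto_sol_bicriteria zero S_def mo[symmetric] by auto
  have W: "weak_pareto_sol UNIV M q = S {1/4..real k + 3/4}"
    unfolding weak_pareto_sol_bicriteria zero S_def mc[symmetric] by auto
  \<comment> \<open>The open interval (Pareto) and the closed one (weak Pareto) are instances of the
    same count.\<close>
  have "finite (components (S I)) \<and> card (components (S I)) = k + 1"
    if "I = {1/4<..<real k + 3/4} \<or> I = {1/4..real k + 3/4}" for I
    unfolding S_def using that T
    by (intro components_reciprocal_curve) (auto simp: k_def)
  then show ?thesis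
    using skew P W unfolding k_def by (intro exI[of _ M] exI[of _ q]) auto
qed

end
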